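(* Let $\mathcal{M}\colon\mathcal{X}^n\to\mathcal{R}$ be an $(\varepsilon,0)$-differentially private algorithm, where $\mathcal{R}$ is an arbitrary finite range. Then for every $\beta\in(0,1)$, $\mathcal{M}$ is also $\left(\beta,\sqrt{2n\ln(2|\mathcal{R}|/\beta)}\,\varepsilon,0\right)$-perfectly generalizing.
   Context: $(\varepsilon,\delta)$-closeness of distributions $\mathcal{J}_1,\mathcal{J}_2$ over $\mathcal{R}$: for every $\mathcal{O}\subseteq\mathcal{R}$, $\Pr_{\mathcal{J}_1}[\mathcal{O}]\le e^{\varepsilon}\Pr_{\mathcal{J}_2}[\mathcal{O}]+\delta$ and vice versa. $\mathcal{M}$ is $(\varepsilon,\delta)$-differentially private if $\mathcal{M}(T),\mathcal{M}(T')$ are $(\varepsilon,\delta)$-close for all $T,T'\in\mathcal{X}^n$ differing in exactly one element. $\mathcal{M}$ is $(\beta,\varepsilon,\delta)$-perfectly generalizing if for every distribution $\mathcal{C}$ over $\mathcal{X}$ there is a distribution $\mathrm{Sim}_{\mathcal{C}}$ over $\mathcal{R}$ such that with probability at least $1-\beta$ over $T\sim_{i.i.d.}\mathcal{C}^n$, $\mathcal{M}(T)$ and $\mathrm{Sim}_{\mathcal{C}}$ are $(\varepsilon,\delta)$-close. *)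

theory Defs
  imports "HOL-Probability.Probability"
begin

text \<open>
  The data domain and the range are measurable spaces \<open>X\<close> and \<open>R\<close>, of which only the carrier and
  the \<open>\<sigma>\<close>-algebra matter. A dataset of size \<open>n\<close> is a point of the \<open>n\<close>-fold product of \<open>X\<close>, i.e. an
  extensional function on \<open>{..<n}\<close>.
\<close>

abbreviation datasets :: "nat \<Rightarrow> 'x measure \<Rightarrow> (nat \<Rightarrow> 'x) measure" where
  "datasets n X \<equiv> Pi\<^sub>M {..<n} (\<lambda>_. X)"

text \<open>
  A randomized algorithm is a Markov kernel, so that the output probabilities are measurable in the
  dataset. If \<open>X\<close> and \<open>R\<close> are count spaces and \<open>X\<close> is countable, measurability holds for every
  family of probability measures on \<open>R\<close>.
\<close>

definition algorithms ::
    "nat \<Rightarrow> 'x measure \<Rightarrow> 'r measure \<Rightarrow> ((nat \<Rightarrow> 'x) \<Rightarrow> 'r measure) set" where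
  "algorithms n X R = datasets n X \<rightarrow>\<^sub>M prob_algebra R"

definition eps_delta_close ::
    "'r measure \<Rightarrow> real \<Rightarrow> real \<Rightarrow> 'r measure \<Rightarrow> 'r measure \<Rightarrow> bool" where
  "eps_delta_close R \<epsilon> \<delta> J1 J2 \<longleftrightarrow>
     (\<forall>O' \<in> sets R. measure J1 O' \<le> exp \<epsilon> * measure J2 O' + \<delta> \<and>
                    measure J2 O' \<le> exp \<epsilon> * measure J1 O' + \<delta>)"

definition neighbouring :: "nat \<Rightarrow> (nat \<Rightarrow> 'x) \<Rightarrow> (nat \<Rightarrow> 'x) \<Rightarrow> bool" where
  "neighbouring n T T' \<longleftrightarrow> card {i \<in> {..<n}. T i \<noteq> T' i} = 1"

definition differentially_private ::
    "nat \<Rightarrow> 'x measure \<Rightarrow> 'r measure \<Rightarrow> real \<Rightarrow> real \<Rightarrow> ((nat \<Rightarrow> 'x) \<Rightarrow> 'r measure) \<Rightarrow> bool" where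
  "differentially_private n X R \<epsilon> \<delta> M \<longleftrightarrow>
     (\<forall>T \<in> space (datasets n X). \<forall>T' \<in> space (datasets n X).
        neighbouring n T T' \<longrightarrow> eps_delta_close R \<epsilon> \<delta> (M T) (M T'))"

text \<open>
  The elements of \<open>space (prob_algebra X)\<close> are exactly the probability measures on the measurable
  space \<open>X\<close>. The distribution of an i.i.d. sample of size \<open>n\<close> from \<open>C\<close> is the product measure
  \<open>datasets n C\<close>. A non-measurable event would get probability \<open>0\<close>, so the bound below also
  demands measurability when \<open>\<beta> < 1\<close>; it is automatic for finite discrete \<open>R\<close> and algorithms
  in the above sense.
\<close>

definition perfectly_generalizing ::
    "nat \<Rightarrow> 'x measure \<Rightarrow> 'r measure \<Rightarrow> real \<Rightarrow> real \<Rightarrow> real \<Rightarrow> ((nat \<Rightarrow> 'x) \<Rightarrow> 'r measure) \<Rightarrow> bool" where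
  "perfectly_generalizing n X R \<beta> \<epsilon> \<delta> M \<longleftrightarrow>
     (\<forall>C \<in> space (prob_algebra X). \<exists>Sim \<in> space (prob_algebra R).
        \<P>(T in datasets n C. eps_delta_close R \<epsilon> \<delta> (M T) Sim) \<ge> 1 - \<beta>)"

end

theory Submission
  imports Defs
begin

text \<open>
  Fix a distribution \<open>C\<close>. By privacy, \<open>f r T = ln (measure (M T) {r})\<close> changes by at most \<open>\<epsilon>\<close> when
  one entry of the dataset \<open>T\<close> changes, so McDiarmid's inequality and a union bound over \<open>r \<in> R\<close>
  show that, with probability at least \<open>1 - \<beta>\<close>, all the \<open>f r T\<close> are within
  \<open>t = sqrt (n * ln (2 * card R / \<beta>) / 2) * \<epsilon>\<close> of their means. The simulator gives \<open>r\<close> a weight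
  proportional to the exponential of the mean of \<open>f r\<close>. Outputs of probability \<open>0\<close> have probability
  \<open>0\<close> for every dataset and get weight \<open>0\<close>. Normalisation doubles the exponent to \<open>2 * t\<close>, which is
  the claimed bound.

  McDiarmid's inequality, with the optimal constant, follows by bounding the moment generating
  function by induction on the number of coordinates: the last coordinate is integrated out with
  Hoeffding's lemma, and the conditional mean again has bounded differences.
\<close>

section \<open>Bounded differences on products and McDiarmid's inequality\<close>

text \<open>Walk from \<open>x\<close> to \<open>y\<close>, replacing one coordinate at a time;
  every intermediate point stays in the product, so each step costs at most \<open>c i\<close>. With
  \<open>c = 0\<close> this turns invariance under single updates into constancy.\<close>

lemma PiE_update_bound:
  fixes f :: "('i \<Rightarrow> 'a) \<Rightarrow> real"
  assumes "finite I" "x \<in> PiE I S" "y \<in> PiE I S"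
    and diff: "\<And>z i v. z \<in> PiE I S \<Longrightarrow> i \<in> I \<Longrightarrow> v \<in> S i \<Longrightarrow> f (z(i := v)) \<le> f z + c i"
  shows "f y \<le> f x + (\<Sum>i\<in>I. c i)"
proof -
  have "f (\<lambda>i. if i \<in> J then y i else x i) \<le> f x + (\<Sum>i\<in>J. c i)" if "finite J" "J \<subseteq> I" for J
    using that
  proof (induction J rule: finite_induct)
    case (insert j J)
    let ?z = "\<lambda>i. if i \<in> J then y i else x i"
    have "?z \<in> PiE I S"
      using assms(2,3) insert.prems by (auto simp: PiE_iff extensional_def)
    moreover have "y j \<in> S j"
      using assms(3) insert.prems by auto
    ultimately have "f (?z(j := y j)) \<le> f ?z + c j"
      using insert.prems by (intro diff) auto
    moreover have "?z(j := y j) = (\<lambda>i. if i \<in> insert j J then y i else x i)"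
      by auto
    ultimately show ?case
      using insert by simp
  qed simp
  \<comment> \<open>Extensionality makes \<open>x\<close> and \<open>y\<close> agree outside
    \<open>I\<close>.\<close>
  moreover have "(\<lambda>i. if i \<in> I then y i else x i) = y"
    using assms(2,3) by (auto simp: fun_eq_iff PiE_iff extensional_def)
  ultimately show ?thesis
    using assms(1) by (metis subset_refl)
qed

context product_prob_space
begin

text \<open>Comparing every point with one fixed \<open>x0\<close>, in both directions, bounds
  \<open>f\<close>, and bounded measurable functions are integrable on a probability space.\<close>

lemma integrable_bounded_differences:
  fixes f :: "('i \<Rightarrow> 'a) \<Rightarrow> real"
  assumes "finite J"
    and [measurable]: "f \<in> borel_measurable (PiM J M)"
    and diff: "\<And>x i y. x \<in> space (PiM J M) \<Longrightarrow> i \<in> J \<Longrightarrow> y \<in> space (M i) \<Longrightarrow> f (x(i := y)) \<le> f x + c i"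
  shows "integrable (PiM J M) f"
proof -
  interpret J: prob_space "PiM J M"
    by (intro prob_space_PiM M.prob_space_axioms)
  obtain x0 where x0: "x0 \<in> space (PiM J M)"
    using J.not_empty by blast
  have "\<bar>f x\<bar> \<le> \<bar>f x0\<bar> + (\<Sum>i\<in>J. c i)" if "x \<in> space (PiM J M)" for x
    using PiE_update_bound[OF assms(1), of x "\<lambda>i. space (M i)" x0 f c]
      PiE_update_bound[OF assms(1), of x0 "\<lambda>i. space (M i)" x f c] diff x0 that
    by (auto simp: space_PiM)
  then show ?thesis
    by (intro J.integrable_const_bound[of _ "\<bar>f x0\<bar> + (\<Sum>i\<in>J. c i)"]) auto
qed

text \<open>The induction generalises over \<open>f\<close>, because its hypothesis is applied to a
  conditional mean of \<open>f\<close>. The one-sided difference condition is in effect two-sided,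
  since an update can be undone.\<close>

lemma mgf_bounded_differences:
  fixes f :: "('i \<Rightarrow> 'a) \<Rightarrow> real"
  assumes "finite J" "l > 0"
    and "f \<in> borel_measurable (PiM J M)"
    and "\<And>x i y. x \<in> space (PiM J M) \<Longrightarrow> i \<in> J \<Longrightarrow> y \<in> space (M i) \<Longrightarrow> f (x(i := y)) \<le> f x + c i"
  shows "(\<integral>\<^sup>+x. exp (l * (f x - integral\<^sup>L (PiM J M) f)) \<partial>PiM J M)
           \<le> ennreal (exp (l\<^sup>2 * (\<Sum>i\<in>J. (c i)\<^sup>2) / 8))"
  using assms(1,3,4)
proof (induction J arbitrary: f rule: finite_induct)
  case empty
  show ?case
    by (simp add: PiM_empty lebesgue_integral_count_space_finite nn_integral_count_space_finite)
next
  case (insert i J)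
  note [measurable] = insert.prems(1)
  note diff = insert.prems(2)
  interpret J: prob_space "PiM J M"
    by (intro prob_space_PiM M.prob_space_axioms)
  have upd_space: "x(i := y) \<in> space (PiM (insert i J) M)"
    if "x \<in> space (PiM J M)" "y \<in> space (M i)" for x y
    using that by (auto simp: space_PiM PiE_iff extensional_def)
  have [measurable]: "(\<lambda>(x, y). f (x(i := y))) \<in> borel_measurable (PiM J M \<Otimes>\<^sub>M M i)"
    using measurable_compose[OF measurable_add_dim insert.prems(1)] by (simp add: split_beta')
  have int: "integrable (PiM (insert i J) M) f"
    using insert.hyps(1) by (intro integrable_bounded_differences[where c = c] insert.prems) auto
  \<comment> \<open>The conditional mean of \<open>f\<close> given all coordinates but
    \<open>i\<close>.\<close>
  define g where "g = (\<lambda>x. \<integral>y. f (x(i := y)) \<partial>M i)"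
  have g_meas [measurable]: "g \<in> borel_measurable (PiM J M)"
    unfolding g_def by measurable
  have Eg: "integral\<^sup>L (PiM (insert i J) M) f = integral\<^sup>L (PiM J M) g"
    unfolding g_def by (rule product_integral_insert[OF insert.hyps int])
  \<comment> \<open>Anchoring the interval at the infimum gives it length \<open>c i\<close>. An
    interval of radius \<open>c i\<close> around one value would be twice as long and lose the
    optimal constant.\<close>
  have bounded: "interval_bounded_random_variable (M i) (\<lambda>y. f (x(i := y)))
      (INF y\<in>space (M i). f (x(i := y))) ((INF y\<in>space (M i). f (x(i := y))) + c i)"
    if x: "x \<in> space (PiM J M)" for x
  proof -
    let ?h = "\<lambda>y. f (x(i := y))"
    have le: "?h y \<le> ?h z + c i" if "y \<in> space (M i)" "z \<in> space (M i)" for y z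
      using diff[OF upd_space[OF x that(2)], of i y] that by (simp only: fun_upd_upd insertI1)
    obtain y0 where "y0 \<in> space (M i)"
      using M.not_empty by blast
    then have bdd: "bdd_below (?h ` space (M i))"
      using le by (intro bdd_belowI2[of _ "?h y0 - c i"]) (simp add: diff_le_eq)
    have "?h y \<in> {(INF z\<in>space (M i). ?h z)..(INF z\<in>space (M i). ?h z) + c i}"
      if y: "y \<in> space (M i)" for y
    proof -
      have "?h y - c i \<le> (INF z\<in>space (M i). ?h z)"
        using le[OF y] M.not_empty by (intro cINF_greatest) (auto simp: diff_le_eq)
      then show ?thesis
        using cINF_lower[OF bdd y] by simp
    qed
    moreover have "?h \<in> borel_measurable (M i)"
      using measurable_compose[OF measurable_component_update[OF x insert.hyps(2)] insert.prems(1)] .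
    ultimately show ?thesis
      by unfold_locales auto
  qed
  \<comment> \<open>Updates at the distinct coordinates \<open>i\<close> and \<open>j\<close>
    commute, so the bound for \<open>f\<close> at \<open>j\<close> survives averaging over
    \<open>i\<close>.\<close>
  have g_diff: "g (x(j := v)) \<le> g x + c j"
    if x: "x \<in> space (PiM J M)" and j: "j \<in> J" and v: "v \<in> space (M j)" for x j v
  proof -
    have x': "x(j := v) \<in> space (PiM J M)"
      using x j v by (auto simp: space_PiM PiE_iff extensional_def)
    have int1: "integrable (M i) (\<lambda>y. f (z(i := y)))" if "z \<in> space (PiM J M)" for z
      using interval_bounded_random_variable.integrable[OF bounded[OF that]] .
    have "g (x(j := v)) \<le> (\<integral>y. f (x(i := y)) + c j \<partial>M i)"
      unfolding g_def
    proof (rule integral_mono)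
      fix y assume y: "y \<in> space (M i)"
      have "(x(j := v))(i := y) = (x(i := y))(j := v)"
        using j insert.hyps(2) by (auto simp: fun_eq_iff)
      moreover have "f ((x(i := y))(j := v)) \<le> f (x(i := y)) + c j"
        using j by (intro diff upd_space x y v) auto
      ultimately show "f ((x(j := v))(i := y)) \<le> f (x(i := y)) + c j"
        by (simp only:)
    qed (use int1 x x' in auto)
    also have "\<dots> = g x + c j"
      unfolding g_def using int1[OF x] by (simp add: M.prob_space)
    finally show ?thesis .
  qed
  let ?E = "integral\<^sup>L (PiM J M) g"
  have "(\<integral>\<^sup>+x. exp (l * (f x - integral\<^sup>L (PiM (insert i J) M) f)) \<partial>PiM (insert i J) M)
      = (\<integral>\<^sup>+x. \<integral>\<^sup>+y. ennreal (exp (l * (f (x(i := y)) - ?E))) \<partial>M i \<partial>PiM J M)"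
    unfolding Eg using insert.hyps by (intro product_nn_integral_insert) auto
  also have "\<dots> \<le> (\<integral>\<^sup>+x. ennreal (exp (l * (g x - ?E))) * ennreal (exp (l\<^sup>2 * (c i)\<^sup>2 / 8)) \<partial>PiM J M)"
  proof (rule nn_integral_mono)
    fix x assume x: "x \<in> space (PiM J M)"
    interpret interval_bounded_random_variable "M i" "\<lambda>y. f (x(i := y))"
      "INF y\<in>space (M i). f (x(i := y))" "(INF y\<in>space (M i). f (x(i := y))) + c i"
      by (rule bounded[OF x])
    \<comment> \<open>Split the exponent at \<open>g x\<close>: one factor is constant in
      \<open>y\<close>, the other is centred and falls under Hoeffding's lemma.\<close>
    have "(\<integral>\<^sup>+y. ennreal (exp (l * (f (x(i := y)) - ?E))) \<partial>M i)
        = (\<integral>\<^sup>+y. ennreal (exp (l * (g x - ?E))) * ennreal (exp (l * (f (x(i := y)) - g x))) \<partial>M i)"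
      by (intro nn_integral_cong) (simp add: algebra_simps flip: ennreal_mult exp_add)
    also have "\<dots> = ennreal (exp (l * (g x - ?E))) * (\<integral>\<^sup>+y. ennreal (exp (l * (f (x(i := y)) - g x))) \<partial>M i)"
      using random_variable by (intro nn_integral_cmult) measurable
    also have "\<dots> \<le> ennreal (exp (l * (g x - ?E))) * ennreal (exp (l\<^sup>2 * (c i)\<^sup>2 / 8))"
      using Hoeffdings_lemma_nn_integral[OF assms(2)] unfolding g_def
      by (intro mult_left_mono) auto
    finally show "(\<integral>\<^sup>+y. ennreal (exp (l * (f (x(i := y)) - ?E))) \<partial>M i)
        \<le> ennreal (exp (l * (g x - ?E))) * ennreal (exp (l\<^sup>2 * (c i)\<^sup>2 / 8))" .
  qed
  also have "\<dots> = (\<integral>\<^sup>+x. ennreal (exp (l * (g x - ?E))) \<partial>PiM J M) * ennreal (exp (l\<^sup>2 * (c i)\<^sup>2 / 8))"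
    by (rule nn_integral_multc) measurable
  also have "\<dots> \<le> ennreal (exp (l\<^sup>2 * (\<Sum>i\<in>J. (c i)\<^sup>2) / 8)) * ennreal (exp (l\<^sup>2 * (c i)\<^sup>2 / 8))"
    by (intro mult_right_mono insert.IH g_meas g_diff) auto
  also have "\<dots> = ennreal (exp (l\<^sup>2 * (\<Sum>i\<in>insert i J. (c i)\<^sup>2) / 8))"
    using insert.hyps by (simp add: algebra_simps add_divide_distrib flip: ennreal_mult exp_add)
  finally show ?case .
qed

theorem McDiarmid_ge:
  fixes f :: "('i \<Rightarrow> 'a) \<Rightarrow> real"
  assumes "finite J" "t > 0" "(\<Sum>i\<in>J. (c i)\<^sup>2) > 0"
    and [measurable]: "f \<in> borel_measurable (PiM J M)"
    and diff: "\<And>x i y. x \<in> space (PiM J M) \<Longrightarrow> i \<in> J \<Longrightarrow> y \<in> space (M i) \<Longrightarrow> f (x(i := y)) \<le> f x + c i"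
  shows "\<P>(x in PiM J M. f x \<ge> integral\<^sup>L (PiM J M) f + t) \<le> exp (-2 * t\<^sup>2 / (\<Sum>i\<in>J. (c i)\<^sup>2))"
proof -
  interpret J: prob_space "PiM J M"
    by (intro prob_space_PiM M.prob_space_axioms)
  define d where "d = (\<Sum>i\<in>J. (c i)\<^sup>2)"
  \<comment> \<open>The minimiser of the Chernoff exponent
    \<open>l\<^sup>2 * d / 8 - l * t\<close>.\<close>
  define l where "l = 4 * t / d"
  have d: "d > 0" and l: "l > 0"
    using assms(2,3) by (simp_all add: d_def l_def)
  let ?E = "integral\<^sup>L (PiM J M) f"
  have "ennreal (\<P>(x in PiM J M. f x \<ge> ?E + t)) = emeasure (PiM J M) {x\<in>space (PiM J M). f x - ?E \<ge> t}"
    by (simp add: J.emeasure_eq_measure algebra_simps)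
  also have "\<dots> \<le> ennreal (exp (-l * t)) * (\<integral>\<^sup>+x\<in>space (PiM J M). exp (l * (f x - ?E)) \<partial>PiM J M)"
    by (intro Chernoff_ineq_nn_integral_ge l) auto
  also have "(\<integral>\<^sup>+x\<in>space (PiM J M). exp (l * (f x - ?E)) \<partial>PiM J M) = (\<integral>\<^sup>+x. exp (l * (f x - ?E)) \<partial>PiM J M)"
    by (intro nn_integral_cong) simp
  also have "ennreal (exp (-l * t)) * \<dots> \<le> ennreal (exp (-l * t)) * ennreal (exp (l\<^sup>2 * d / 8))"
    unfolding d_def using diff by (intro mult_left_mono mgf_bounded_differences assms l) auto
  also have "\<dots> = ennreal (exp (l\<^sup>2 * d / 8 - l * t))"
    by (simp add: algebra_simps flip: ennreal_mult exp_add)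
  also have "l\<^sup>2 * d / 8 - l * t = -2 * t\<^sup>2 / d"
    using d by (simp add: l_def field_simps power2_eq_square)
  finally show ?thesis
    by (simp add: d_def)
qed

theorem McDiarmid_abs_ge:
  fixes f :: "('i \<Rightarrow> 'a) \<Rightarrow> real"
  assumes "finite J" "t > 0" "(\<Sum>i\<in>J. (c i)\<^sup>2) > 0"
    and [measurable]: "f \<in> borel_measurable (PiM J M)"
    and diff: "\<And>x i y. x \<in> space (PiM J M) \<Longrightarrow> i \<in> J \<Longrightarrow> y \<in> space (M i) \<Longrightarrow> f (x(i := y)) \<le> f x + c i"
  shows "\<P>(x in PiM J M. \<bar>f x - integral\<^sup>L (PiM J M) f\<bar> \<ge> t) \<le> 2 * exp (-2 * t\<^sup>2 / (\<Sum>i\<in>J. (c i)\<^sup>2))"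
proof -
  interpret J: prob_space "PiM J M"
    by (intro prob_space_PiM M.prob_space_axioms)
  let ?E = "integral\<^sup>L (PiM J M) f"
  \<comment> \<open>For the lower tail, start from the updated point and put the old value
    \<open>x i\<close> back.\<close>
  have neg_diff: "- f (x(i := y)) \<le> - f x + c i"
    if "x \<in> space (PiM J M)" "i \<in> J" "y \<in> space (M i)" for x i y
  proof -
    have "x(i := y) \<in> space (PiM J M)" "x i \<in> space (M i)"
      using that by (auto simp: space_PiM PiE_iff extensional_def)
    from diff[OF this(1) that(2) this(2)] show ?thesis
      by simp
  qed
  have "{x\<in>space (PiM J M). \<bar>f x - ?E\<bar> \<ge> t} =
      {x\<in>space (PiM J M). f x \<ge> ?E + t} \<union> {x\<in>space (PiM J M). - f x \<ge> - ?E + t}"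
    by auto
  then have "\<P>(x in PiM J M. \<bar>f x - ?E\<bar> \<ge> t)
      \<le> \<P>(x in PiM J M. f x \<ge> ?E + t) + \<P>(x in PiM J M. - f x \<ge> - ?E + t)"
    by (simp add: measure_Un_le)
  also have "\<P>(x in PiM J M. f x \<ge> ?E + t) \<le> exp (-2 * t\<^sup>2 / (\<Sum>i\<in>J. (c i)\<^sup>2))"
    using assms by (intro McDiarmid_ge) auto
  also have "\<P>(x in PiM J M. - f x \<ge> - ?E + t) \<le> exp (-2 * t\<^sup>2 / (\<Sum>i\<in>J. (c i)\<^sup>2))"
    using McDiarmid_ge[of J t c "\<lambda>x. - f x"] assms(1-3) neg_diff by simp
  finally show ?thesis
    by simp
qed

end

section \<open>Pure privacy under single updates, and closeness on a finite range\<close>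

text \<open>Neighbouring datasets differ in exactly one entry, so an update that leaves
  \<open>T\<close> unchanged is treated separately; there \<open>\<epsilon> \<ge> 0\<close> gives
  the bound.\<close>

lemma differentially_private_update:
  assumes "differentially_private n X R \<epsilon> 0 M" "\<epsilon> \<ge> 0" "A \<in> sets R"
    and "T \<in> space (datasets n X)" "i < n" "v \<in> space X"
  shows "measure (M (T(i := v))) A \<le> exp \<epsilon> * measure (M T) A"
proof (cases "v = T i")
  case True
  then show ?thesis
    using \<open>\<epsilon> \<ge> 0\<close> by (simp add: mult_le_cancel_right1)
next
  case False
  then have "{j \<in> {..<n}. (T(i := v)) j \<noteq> T j} = {i}"
    using \<open>i < n\<close> by auto
  then have "neighbouring n (T(i := v)) T"
    by (simp add: neighbouring_def)
  moreover have "T(i := v) \<in> space (datasets n X)"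
    using assms(4-6) by (auto simp: space_PiM PiE_iff extensional_def)
  ultimately show ?thesis
    using assms(1,3,4) by (auto simp: differentially_private_def eps_delta_close_def)
qed

text \<open>With \<delta> = 0 the inequalities for single outcomes can be summed over any event, so
  only the probabilities of singletons have to be compared.\<close>

lemma eps_close_count_spaceI:
  assumes "finite R" "J1 \<in> space (prob_algebra (count_space R))" "J2 \<in> space (prob_algebra (count_space R))"
    and "\<And>r. r \<in> R \<Longrightarrow> measure J1 {r} \<le> exp \<epsilon> * measure J2 {r}"
    and "\<And>r. r \<in> R \<Longrightarrow> measure J2 {r} \<le> exp \<epsilon> * measure J1 {r}"
  shows "eps_delta_close (count_space R) \<epsilon> 0 J1 J2"
proof -
  have sum: "measure J A = (\<Sum>r\<in>A. measure J {r})"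
    if "J \<in> space (prob_algebra (count_space R))" "A \<subseteq> R" for J A
  proof -
    interpret prob_space J
      using that by (simp add: space_prob_algebra)
    have "sets J = Pow R"
      using that by (simp add: space_prob_algebra)
    then show ?thesis
      using that(2) finite_subset[OF that(2) assms(1)]
      by (intro finite_measure_eq_sum_singleton) auto
  qed
  have le: "measure J A \<le> exp \<epsilon> * measure J' A"
    if "J \<in> space (prob_algebra (count_space R))" "J' \<in> space (prob_algebra (count_space R))"
      and "\<And>r. r \<in> R \<Longrightarrow> measure J {r} \<le> exp \<epsilon> * measure J' {r}" and "A \<subseteq> R" for J J' A
    unfolding sum[OF that(1,4)] sum[OF that(2,4)] sum_distrib_left
    using that(3,4) by (intro sum_mono) auto
  show ?thesis
    unfolding eps_delta_close_def
    using le[OF assms(2,3,4)] le[OF assms(3,2,5)] by simp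
qed

lemma point_measure_in_prob_algebra:
  fixes q :: "'r \<Rightarrow> real"
  assumes "finite R" "\<And>r. r \<in> R \<Longrightarrow> q r \<ge> 0" "(\<Sum>r\<in>R. q r) = 1"
  shows "point_measure R q \<in> space (prob_algebra (count_space R))"
proof -
  have "emeasure (point_measure R q) R = 1"
    using assms by (simp add: emeasure_point_measure_finite sum_ennreal)
  then show ?thesis
    by (auto simp: space_prob_algebra sets_point_measure space_point_measure intro!: prob_spaceI)
qed

text \<open>Normalising the weights costs a second factor \<open>exp t\<close>, because their sum is only known up to
  \<open>exp t\<close>.\<close>

lemma eps_close_normalized_weights:
  fixes q :: "'r \<Rightarrow> real"
  assumes "finite R" "J \<in> space (prob_algebra (count_space R))"
    and q: "\<And>r. r \<in> R \<Longrightarrow> q r \<ge> 0"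
    and le1: "\<And>r. r \<in> R \<Longrightarrow> measure J {r} \<le> exp t * q r"
    and le2: "\<And>r. r \<in> R \<Longrightarrow> q r \<le> exp t * measure J {r}"
  shows "eps_delta_close (count_space R) (2 * t) 0 J (point_measure R (\<lambda>r. q r / (\<Sum>r\<in>R. q r)))"
proof -
  define Q where "Q = (\<Sum>r\<in>R. q r)"
  interpret J: prob_space J
    using assms(2) by (simp add: space_prob_algebra)
  have sets_J: "sets J = Pow R" and space_J: "space J = R"
    using assms(2) sets_eq_imp_space_eq[of J "count_space R"] by (auto simp: space_prob_algebra)
  have sum_J: "(\<Sum>r\<in>R. measure J {r}) = 1"
    using J.finite_measure_eq_sum_singleton[of R] assms(1) J.prob_space by (simp add: sets_J space_J)
  \<comment> \<open>\<open>J\<close> has mass 1, so summing \<open>le1\<close> and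
    \<open>le2\<close> over \<open>R\<close> puts \<open>Q\<close> between \<open>exp (- t)\<close>
    and \<open>exp t\<close>. The upper bound serves one direction of closeness, the lower bound the
    other.\<close>
  have "1 \<le> exp t * Q"
    unfolding Q_def sum_J[symmetric] sum_distrib_left using le1 by (rule sum_mono)
  moreover have Q_le: "Q \<le> exp t"
    using sum_mono[of R q "\<lambda>r. exp t * measure J {r}"] le2 sum_J
    by (simp add: Q_def flip: sum_distrib_left)
  ultimately have Q: "Q > 0"
    by (smt (verit) exp_gt_zero mult_nonneg_nonpos)
  have exp2: "exp (2 * t) = exp t * exp t"
    by (simp flip: exp_add)
  have m: "measure (point_measure R (\<lambda>r. q r / Q)) {r} = q r / Q" if "r \<in> R" for r
    using that q Q assms(1) by (subst measure_point_measure_finite_if) auto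
  have "eps_delta_close (count_space R) (2 * t) 0 J (point_measure R (\<lambda>r. q r / Q))"
  proof (rule eps_close_count_spaceI)
    show "point_measure R (\<lambda>r. q r / Q) \<in> space (prob_algebra (count_space R))"
      using assms(1) q Q by (intro point_measure_in_prob_algebra) (auto simp: Q_def simp flip: sum_divide_distrib)
  next
    fix r assume r: "r \<in> R"
    have "measure J {r} \<le> exp t * q r"
      by (rule le1[OF r])
    also have "\<dots> = exp t * Q * (q r / Q)"
      using Q by simp
    also have "\<dots> \<le> exp t * exp t * (q r / Q)"
      using Q_le Q q[OF r] by (intro mult_right_mono mult_left_mono) auto
    finally show "measure J {r} \<le> exp (2 * t) * measure (point_measure R (\<lambda>r. q r / Q)) {r}"
      by (simp add: m[OF r] exp2)
    have "q r / Q \<le> exp t * q r"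
      using mult_left_mono[OF \<open>1 \<le> exp t * Q\<close> q[OF r]] Q by (simp add: field_simps)
    also have "\<dots> \<le> exp t * (exp t * measure J {r})"
      using le2[OF r] by (intro mult_left_mono) auto
    finally show "measure (point_measure R (\<lambda>r. q r / Q)) {r} \<le> exp (2 * t) * measure J {r}"
      unfolding m[OF r] exp2 by (simp only: mult_ac)
  qed (use assms in auto)
  then show ?thesis
    by (simp add: Q_def)
qed

text \<open>The output on any one dataset \<open>T0\<close> is a simulator that works for all
  datasets. This settles the degenerate cases, in which the deviation \<open>t\<close> would be 0
  and McDiarmid's inequality does not apply.\<close>

lemma constant_algorithm_perfectly_generalizing:
  assumes "M \<in> algorithms n X R" "\<epsilon> \<ge> 0" "\<beta> \<ge> 0"
    and const: "\<And>T T' A. T \<in> space (datasets n X) \<Longrightarrow> T' \<in> space (datasets n X) \<Longrightarrow> A \<in> sets R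
      \<Longrightarrow> measure (M T) A = measure (M T') A"
  shows "perfectly_generalizing n X R \<beta> \<epsilon> 0 M"
  unfolding perfectly_generalizing_def
proof
  fix C assume "C \<in> space (prob_algebra X)"
  then have C: "prob_space C" and sets_C: "sets C = sets X"
    by (auto simp: space_prob_algebra)
  interpret D: prob_space "datasets n C"
    by (intro prob_space_PiM C)
  have space_D: "space (datasets n C) = space (datasets n X)"
    by (intro sets_eq_imp_space_eq sets_PiM_cong sets_C refl)
  obtain T0 where T0: "T0 \<in> space (datasets n X)"
    using D.not_empty unfolding space_D by blast
  have exp1: "measure N A \<le> exp \<epsilon> * measure N A" for N :: "'b measure" and A
    using assms(2) by (simp add: mult_le_cancel_right1)
  have "eps_delta_close R \<epsilon> 0 (M T) (M T0)" if "T \<in> space (datasets n X)" for T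
    using const[OF that T0] exp1 by (auto simp: eps_delta_close_def)
  then have "{T \<in> space (datasets n C). eps_delta_close R \<epsilon> 0 (M T) (M T0)} = space (datasets n C)"
    by (auto simp: space_D)
  moreover have "M T0 \<in> space (prob_algebra R)"
    using assms(1) T0 by (auto simp: algorithms_def dest: measurable_space)
  ultimately show "\<exists>Sim\<in>space (prob_algebra R).
      1 - \<beta> \<le> \<P>(T in datasets n C. eps_delta_close R \<epsilon> 0 (M T) Sim)"
    using \<open>\<beta> \<ge> 0\<close> by (intro bexI[of _ "M T0"]) (simp_all add: D.prob_space)
qed

text \<open>A multiplicative bound sends probability 0 to probability 0, so the 0-1 indicator of
  positive probability cannot increase under an update. The support of the output is thus common to
  all datasets, and logarithms are taken only there.\<close>

lemma differentially_private_zero_iff: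
  assumes "differentially_private n X R \<epsilon> 0 M" "\<epsilon> \<ge> 0" "A \<in> sets R"
    and "T \<in> space (datasets n X)" "T' \<in> space (datasets n X)"
  shows "measure (M T) A = 0 \<longleftrightarrow> measure (M T') A = 0"
proof -
  let ?f = "\<lambda>T. if measure (M T) A = 0 then 0 else 1 :: real"
  have upd: "?f (T(i := v)) \<le> ?f T + 0"
    if "T \<in> PiE {..<n} (\<lambda>_. space X)" "i \<in> {..<n}" "v \<in> space X" for T i v
  proof -
    have "measure (M (T(i := v))) A \<le> exp \<epsilon> * measure (M T) A"
      using that by (intro differentially_private_update[OF assms(1-3)]) (simp_all add: space_PiM)
    then show ?thesis
      using measure_le_0_iff[of "M (T(i := v))" A] by (cases "measure (M T) A = 0") simp_all
  qed
  have "?f T' \<le> ?f T" if "T \<in> space (datasets n X)" "T' \<in> space (datasets n X)" for T T'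
    using PiE_update_bound[of "{..<n}" T "\<lambda>_. space X" T' ?f "\<lambda>_. 0", OF _ _ _ upd] that
    unfolding space_PiM by simp
  from this[OF assms(4,5)] this[OF assms(5,4)] show ?thesis
    by (auto split: if_splits)
qed

section \<open>From concentration of log-probabilities to the simulator\<close>

theorem theorem5p4:
  fixes X :: "'x measure" and R :: "'r set" and M :: "(nat \<Rightarrow> 'x) \<Rightarrow> 'r measure"
    and n :: nat and \<epsilon> \<beta> :: real
  assumes "finite R"
    and "M \<in> algorithms n X (count_space R)"
    and "\<epsilon> \<ge> 0"
    and "differentially_private n X (count_space R) \<epsilon> 0 M"
    and "0 < \<beta>" and "\<beta> < 1"
  shows "perfectly_generalizing n X (count_space R) \<beta>
           (sqrt (2 * real n * ln (2 * real (card R) / \<beta>)) * \<epsilon>) 0 M"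
proof (cases "n = 0 \<or> \<epsilon> = 0")
  case True
  have "measure (M T') A \<le> measure (M T) A"
    if "T \<in> space (datasets n X)" "T' \<in> space (datasets n X)" "A \<in> sets (count_space R)" for T T' A
  proof -
    \<comment> \<open>Vacuous for \<open>n = 0\<close>; for \<open>\<epsilon> = 0\<close> the
      privacy factor is \<open>exp 0 = 1\<close>.\<close>
    have "measure (M (S(i := v))) A \<le> measure (M S) A + 0"
      if "S \<in> PiE {..<n} (\<lambda>_. space X)" "i \<in> {..<n}" "v \<in> space X" for S i v
      using differentially_private_update[OF assms(4,3) \<open>A \<in> _\<close>, of S i v] that True
      by (auto simp: space_PiM)
    from PiE_update_bound[of "{..<n}" T "\<lambda>_. space X" T' "\<lambda>T. measure (M T) A" "\<lambda>_. 0", OF _ _ _ this]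
    show ?thesis
      using that by (simp add: space_PiM)
  qed
  then show ?thesis
    using True assms(2,5) by (intro constant_algorithm_perfectly_generalizing) (auto intro: antisym)
next
  case False
  then have n: "n > 0" and \<epsilon>: "\<epsilon> > 0"
    using assms(3) by auto
  define L where "L = ln (2 * real (card R) / \<beta>)"
  \<comment> \<open>Chosen so that \<open>2 * t\<^sup>2 / (n * \<epsilon>\<^sup>2) = L\<close>:
    McDiarmid's two-sided bound is then \<open>2 * exp (- L) = \<beta> / card R\<close>, an equal
    share of \<beta> for each outcome.\<close>
  define t where "t = sqrt (real n * L / 2) * \<epsilon>"
  have eps': "sqrt (2 * real n * L) * \<epsilon> = 2 * t"
  proof -
    have "sqrt (2 * real n * L) = sqrt (4 * (real n * L / 2))"
      by simp
    then show ?thesis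
      unfolding t_def real_sqrt_mult[of 4] by simp
  qed
  show ?thesis
    unfolding perfectly_generalizing_def L_def[symmetric] eps'
  proof
    fix C assume "C \<in> space (prob_algebra X)"
    then have C: "prob_space C" and sets_C: "sets C = sets X"
      by (auto simp: space_prob_algebra)
    interpret C: prob_space C
      by (rule C)
    let ?D = "datasets n C"
    interpret D: prob_space ?D
      by (intro prob_space_PiM C)
    interpret P: product_prob_space "\<lambda>_. C" "{..<n}"
      by unfold_locales
    have sets_D: "sets ?D = sets (datasets n X)"
      by (intro sets_PiM_cong sets_C refl)
    have space_D: "space ?D = space (datasets n X)"
      by (rule sets_eq_imp_space_eq[OF sets_D])
    have space_C: "space C = space X"
      by (rule sets_eq_imp_space_eq[OF sets_C])
    have M_meas [measurable]: "M \<in> ?D \<rightarrow>\<^sub>M prob_algebra (count_space R)"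
      using assms(2) unfolding algorithms_def measurable_cong_sets[OF sets_D refl] .
    have M_space: "M T \<in> space (prob_algebra (count_space R))" if "T \<in> space ?D" for T
      using measurable_space[OF M_meas that] .
    have [measurable]: "(\<lambda>T. measure (M T) A) \<in> borel_measurable ?D" if "A \<subseteq> R" for A
      using measurable_compose[OF M_meas measurable_measure_prob_algebra] that by simp
    obtain T0 where T0: "T0 \<in> space ?D"
      using D.not_empty by blast
    \<comment> \<open>\<open>R\<close> carries the probability measure \<open>M T0\<close>. Together
      with \<open>\<beta> < 1\<close> this makes the logarithm \<open>L\<close> positive, hence also
      \<open>t\<close>.\<close>
    have "R \<noteq> {}"
      using prob_space.not_empty[of "M T0"] M_space[OF T0]
        sets_eq_imp_space_eq[of "M T0" "count_space R"]
      by (auto simp: space_prob_algebra)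
    then have R: "card R > 0"
      using assms(1) by (simp add: card_gt_0_iff)
    then have "2 * real (card R) / \<beta> > 1"
      using assms(5,6) by (simp add: less_divide_eq)
    then have L: "L > 0" and exp_L: "exp (- L) = \<beta> / (2 * real (card R))"
      unfolding L_def by (simp_all add: exp_minus)
    then have t: "t > 0"
      using n \<epsilon> by (simp add: t_def)
    define p where "p = (\<lambda>r T. measure (M T) {r})"
    \<comment> \<open>The common support of all outputs; by \<open>p_zero\<close> below it does not
      depend on the choice of \<open>T0\<close>.\<close>
    define S where "S = {r \<in> R. p r T0 > 0}"
    \<comment> \<open>On \<open>S\<close> the weight is the geometric mean of \<open>p r\<close>
      over the sample. Off \<open>S\<close> it is set to 0 explicitly, since there \<open>ln\<close>
      would be taken at 0, where its value has no meaning.\<close>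
    define q where "q = (\<lambda>r. if r \<in> S then exp (\<integral>T. ln (p r T) \<partial>?D) else 0)"
    define bad where "bad = (\<lambda>r. {T \<in> space ?D. \<bar>ln (p r T) - (\<integral>T. ln (p r T) \<partial>?D)\<bar> \<ge> t})"
    have [measurable]: "p r \<in> borel_measurable ?D" if "r \<in> R" for r
      unfolding p_def using that by simp
    have p_zero: "p r T = 0 \<longleftrightarrow> p r T0 = 0" if "r \<in> R" "T \<in> space ?D" for r T
      unfolding p_def
      using differentially_private_zero_iff[OF assms(4,3), of "{r}" T T0] that T0 by (simp add: space_D)
    have p_nonneg: "p r T \<ge> 0" for r T
      by (simp add: p_def)
    have p_pos: "p r T > 0" if "r \<in> S" "T \<in> space ?D" for r T
      using p_zero[of r T] that p_nonneg[of r T] by (auto simp: S_def)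
    have fin_S: "finite S" and S_le: "card S \<le> card R"
      using assms(1) by (auto simp: S_def intro: card_mono)
    have bad_sets: "bad r \<in> sets ?D" if "r \<in> S" for r
    proof -
      have [measurable]: "p r \<in> borel_measurable ?D"
        using that by (simp add: S_def)
      show ?thesis
        unfolding bad_def by measurable
    qed
    have bad_prob: "measure ?D (bad r) \<le> \<beta> / real (card R)" if r: "r \<in> S" for r
    proof -
      have [measurable]: "p r \<in> borel_measurable ?D"
        using r by (simp add: S_def)
      have diff: "ln (p r (T(i := v))) \<le> ln (p r T) + \<epsilon>"
        if "T \<in> space ?D" "i \<in> {..<n}" "v \<in> space C" for T i v
      proof -
        have upd: "T(i := v) \<in> space ?D"
          using that by (auto simp: space_PiM PiE_iff extensional_def)
        have "p r (T(i := v)) \<le> exp \<epsilon> * p r T"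
          unfolding p_def using differentially_private_update[OF assms(4,3), of "{r}" T i v] that r
          by (simp add: space_D space_C S_def)
        \<comment> \<open>The factor \<open>exp \<epsilon>\<close> becomes the additive difference
          \<epsilon>; positivity on \<open>S\<close> makes the logarithms meaningful.\<close>
        then have "ln (p r (T(i := v))) \<le> ln (exp \<epsilon> * p r T)"
          using p_pos[OF r upd] by (intro ln_mono) auto
        also have "\<dots> = ln (p r T) + \<epsilon>"
          using p_pos[OF r \<open>T \<in> space ?D\<close>] by (simp add: ln_mult)
        finally show ?thesis .
      qed
      have "measure ?D (bad r) \<le> 2 * exp (-2 * t\<^sup>2 / (\<Sum>i<n. \<epsilon>\<^sup>2))"
        unfolding bad_def using t n \<epsilon> diff by (intro P.McDiarmid_abs_ge) auto
      also have "-2 * t\<^sup>2 / (\<Sum>i<n. \<epsilon>\<^sup>2) = - L"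
        using n \<epsilon> L by (simp add: t_def power_mult_distrib)
      finally show ?thesis
        by (simp add: exp_L)
    qed
    have "measure ?D (\<Union>r\<in>S. bad r) \<le> (\<Sum>r\<in>S. measure ?D (bad r))"
      using fin_S bad_sets by (intro D.finite_measure_subadditive_finite) auto
    also have "\<dots> \<le> real (card S) * (\<beta> / real (card R))"
      using bad_prob by (intro sum_bounded_above) auto
    also have "\<dots> \<le> real (card R) * (\<beta> / real (card R))"
      using S_le assms(5) by (intro mult_right_mono) auto
    also have "\<dots> = \<beta>"
      using R by simp
    finally have bad_le: "measure ?D (\<Union>r\<in>S. bad r) \<le> \<beta>" .
    let ?Sim = "point_measure R (\<lambda>r. q r / (\<Sum>r\<in>R. q r))"
    have q_nonneg: "q r \<ge> 0" for r
      by (simp add: q_def)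
    have close: "eps_delta_close (count_space R) (2 * t) 0 (M T) ?Sim"
      if T: "T \<in> space ?D - (\<Union>r\<in>S. bad r)" for T
    proof (rule eps_close_normalized_weights[OF assms(1)])
      show "M T \<in> space (prob_algebra (count_space R))"
        using M_space T by simp
    next
      fix r assume r: "r \<in> R"
      have "p r T \<le> exp t * q r \<and> q r \<le> exp t * p r T"
      proof (cases "r \<in> S")
        case True
        let ?E = "\<integral>T. ln (p r T) \<partial>?D"
        have "\<bar>ln (p r T) - ?E\<bar> < t"
          using T True by (auto simp: bad_def)
        then have "exp (ln (p r T)) \<le> exp (t + ?E)" "exp ?E \<le> exp (t + ln (p r T))"
          unfolding exp_le_cancel_iff by linarith+
        then show ?thesis
          using True T p_pos by (simp add: q_def exp_add)
      next
        case False
        then have "p r T0 = 0"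
          using r p_nonneg[of r T0] by (auto simp: S_def)
        then show ?thesis
          using False p_zero[OF r, of T] T by (simp add: q_def)
      qed
      then show "measure (M T) {r} \<le> exp t * q r" "q r \<le> exp t * measure (M T) {r}"
        by (simp_all add: p_def)
    qed (rule q_nonneg)
    have sum_pos: "(\<Sum>r\<in>R. q r) > 0"
    proof -
      interpret T0: prob_space "M T0"
        using M_space[OF T0] by (simp add: space_prob_algebra)
      have "sets (M T0) = Pow R" "space (M T0) = R"
        using M_space[OF T0] sets_eq_imp_space_eq[of "M T0" "count_space R"]
        by (auto simp: space_prob_algebra)
      then have "(\<Sum>r\<in>R. p r T0) = 1"
        using T0.finite_measure_eq_sum_singleton[of R] assms(1) T0.prob_space by (simp add: p_def)
      then obtain r where "r \<in> R" "p r T0 \<noteq> 0"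
        by (metis sum.neutral zero_neq_one)
      then have "r \<in> S"
        using p_nonneg[of r T0] by (simp add: S_def)
      then show ?thesis
        using assms(1) \<open>r \<in> R\<close> q_nonneg by (intro sum_pos2[of R r]) (auto simp: q_def)
    qed
    have Sim: "?Sim \<in> space (prob_algebra (count_space R))"
      using assms(1) sum_pos q_nonneg
      by (intro point_measure_in_prob_algebra) (auto simp flip: sum_divide_distrib)
    have close_sets: "{T \<in> space ?D. eps_delta_close (count_space R) (2 * t) 0 (M T) ?Sim} \<in> sets ?D"
      unfolding eps_delta_close_def using assms(1)
      by (intro sets.sets_Collect_finite_All) auto
    have "1 - \<beta> \<le> measure ?D (space ?D - (\<Union>r\<in>S. bad r))"
      using bad_le fin_S bad_sets by (subst D.prob_compl) auto
    also have "\<dots> \<le> \<P>(T in ?D. eps_delta_close (count_space R) (2 * t) 0 (M T) ?Sim)"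
      using close close_sets by (intro D.finite_measure_mono) auto
    finally show "\<exists>Sim\<in>space (prob_algebra (count_space R)).
        1 - \<beta> \<le> \<P>(T in ?D. eps_delta_close (count_space R) (2 * t) 0 (M T) Sim)"
      using Sim by blast
  qed
qed

end
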